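(* There is an absolute constant $c>0$ such that for all sufficiently large $n$, $$g(K^3_n,K^3_n)\ge 2^{2^{cn}}.$$ In particular, $g(K^3_n,K^3_n)=\mathrm{twr}_3(\Theta(n))$.
   Context: A set of points in the plane is in general position if no three are collinear. $g(K^3_n,K^3_n)$ is the minimum integer $N$ such that for every set of $N$ points in the plane in general position and every coloring of its 3-element subsets (triples) with 2 colors, there is a subset $S$ of $n$ points in convex position all of whose triples receive the same color. The tower function is defined by $\mathrm{twr}_1(x)=x$ and $\mathrm{twr}_{i+1}(x)=2^{\mathrm{twr}_i(x)}$, so $\mathrm{twr}_3(x)=2^{2^x}$. *)

theory Defs
  imports "HOL-Analysis.Analysis" "HOL-Library.Ramsey" "HOL-Library.Landau_Symbols"
begin

definition general_position :: "(real ^ 2) set \<Rightarrow> bool" where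
  "general_position P \<longleftrightarrow> (\<forall>T \<in> nsets P 3. \<not> collinear T)"

definition convex_position :: "(real ^ 2) set \<Rightarrow> bool" where
  "convex_position S \<longleftrightarrow> (\<forall>p \<in> S. p \<notin> convex hull (S - {p}))"

text \<open>
  A colouring is a total function on sets of points with values in \<open>bool\<close>; only its values on
  triples matter.
\<close>

definition monochromatic :: "((real ^ 2) set \<Rightarrow> bool) \<Rightarrow> (real ^ 2) set \<Rightarrow> bool" where
  "monochromatic col S \<longleftrightarrow> (\<exists>c. \<forall>T \<in> nsets S 3. col T = c)"

definition convex_ramsey :: "nat \<Rightarrow> nat \<Rightarrow> bool" where
  "convex_ramsey n N \<longleftrightarrow>
    (\<forall>P col. finite P \<longrightarrow> card P = N \<longrightarrow> general_position P \<longrightarrow>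
      (\<exists>S \<in> nsets P n. convex_position S \<and> monochromatic col S))"

text \<open>The number \<open>g(K\<^sup>3\<^sub>n, K\<^sup>3\<^sub>n)\<close>.\<close>

definition g_K3 :: "nat \<Rightarrow> nat" where
  "g_K3 n = (LEAST N. convex_ramsey n N)"

text \<open>The tower function is indexed from 1; its value at index 0 is a dummy.\<close>

fun twr :: "nat \<Rightarrow> real \<Rightarrow> real" where
  "twr 0 x = 0"
| "twr (Suc 0) x = x"
| "twr (Suc (Suc i)) x = 2 powr twr (Suc i) x"

end

theory Submission
  imports Defs "HOL-Library.Sublist"
begin

text \<open>
  Upper bound: colour a triple of points by its given colour together with its orientation. A list of
  points all of whose triples have the same orientation is in convex position, so the
  Erdos--Rado bound for four colours applies directly.

  Lower bound: index \<open>2 ^ m\<close> points by the subsets of \<open>{..<m}\<close> and place them so that a triple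
  \<open>A, B, C\<close>, ordered by abscissa, turns left or right according to whether the largest element of the
  symmetric difference of \<open>A\<close> and \<open>B\<close> is smaller or larger than that of \<open>B\<close> and \<open>C\<close>. Colour the
  triple by the colour of this pair of elements in a graph on \<open>{..<m}\<close> without homogeneous sets of
  size \<open>4 * log 2 m\<close>. A monochromatic set in convex position contains a cup or a cap of half its size;
  the elements separating its leftmost (rightmost) point from the others are distinct and
  form a homogeneous set. This is the stepping-up construction in which the two additional colours
  it normally needs are replaced by the orientation.
\<close>

section \<open>An Erdos--Rado bound for triples\<close>

lemma length_eq_sum_length_filter:
  fixes g :: "'a \<Rightarrow> 'c::finite"
  shows "length xs = (\<Sum>c\<in>UNIV. length (filter (\<lambda>x. g x = c) xs))"
proof (induction xs)
  case (Cons x xs)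
  have "(\<Sum>c\<in>UNIV. length (filter (\<lambda>x. g x = c) (x # xs))) =
        (\<Sum>c\<in>UNIV. (if g x = c then 1 else 0) + length (filter (\<lambda>x. g x = c) xs))"
    by (intro sum.cong) auto
  also have "\<dots> = 1 + (\<Sum>c\<in>UNIV. length (filter (\<lambda>x. g x = c) xs))"
    by (subst sum.distrib) simp
  finally show ?case using Cons by simp
qed simp

lemma pigeonhole_list:
  fixes g :: "'a \<Rightarrow> 'c::finite"
  obtains c where "length xs \<le> CARD('c) * length (filter (\<lambda>x. g x = c) xs)"
proof (rule ccontr)
  assume "\<not> thesis"
  with that have "CARD('c) * length (filter (\<lambda>x. g x = c) xs) < length xs" for c
    by (meson not_le)
  then have "(\<Sum>c\<in>(UNIV::'c set). CARD('c) * length (filter (\<lambda>x. g x = c) xs))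
      < (\<Sum>c\<in>(UNIV::'c set). length xs)"
    by (intro sum_strict_mono) auto
  then show False
    by (simp add: length_eq_sum_length_filter[of xs g] flip: sum_distrib_left)
qed

lemma set_mono_subseq: "subseq xs ys \<Longrightarrow> set xs \<subseteq> set ys"
  by (metis set_nths_subset subseq_conv_nths)

lemma distinct_subseq: "subseq xs ys \<Longrightarrow> distinct ys \<Longrightarrow> distinct xs"
  by (metis distinct_nthsI subseq_conv_nths)

text \<open>Greedy choice: keep the head \<open>x\<close> and only those later entries that give
  \<open>x\<close> its most frequent colour. Each step costs a factor of about
  \<open>CARD('c)\<close>, and in the list that remains the colour of a pair is fixed by its first
  entry.\<close>

lemma end_homogeneous_pairs:
  fixes f :: "'a \<Rightarrow> 'a \<Rightarrow> 'c::finite"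
  assumes "CARD('c) \<ge> 2" "distinct xs" "length xs \<ge> CARD('c) ^ t"
  shows "\<exists>ys h. subseq ys xs \<and> length ys = t \<and> sorted_wrt (\<lambda>x y. f x y = h x) ys"
  using assms(2,3)
proof (induction t arbitrary: xs)
  case 0
  then show ?case by (intro exI[of _ "[]"]) auto
next
  case (Suc t)
  let ?q = "CARD('c)"
  have "?q ^ Suc t \<ge> 1" by (simp add: Suc_le_eq)
  then obtain x xs' where xs: "xs = x # xs'"
    using Suc.prems by (cases xs) auto
  obtain c where c: "length xs' \<le> ?q * length (filter (\<lambda>y. f x y = c) xs')"
    using pigeonhole_list by metis
  let ?zs = "filter (\<lambda>y. f x y = c) xs'"
  have "?q * ?q ^ t \<le> Suc (?q * length ?zs)"
    using Suc.prems(2) c xs by simp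
  \<comment> \<open>As there are at least two colours, the one place lost to the head
    \<open>x\<close> is absorbed by rounding.\<close>
  then have "?q * ?q ^ t < ?q * Suc (length ?zs)"
    using assms(1) by simp
  then have "?q ^ t \<le> length ?zs"
    by (metis less_Suc_eq_le mult_less_cancel1)
  then obtain ys h where ys: "subseq ys ?zs" "length ys = t" "sorted_wrt (\<lambda>x y. f x y = h x) ys"
    using Suc.IH[of ?zs] Suc.prems(1) xs by auto
  have sub: "subseq ys xs'"
    using ys(1) subseq_filter_left subseq_order.trans by blast
  have mem: "set ys \<subseteq> {y. f x y = c} \<inter> set xs'"
    using set_mono_subseq[OF ys(1)] by auto
  have "sorted_wrt (\<lambda>y z. f y z = (h(x := c)) y) ys"
    using ys(3) by (rule sorted_wrt_mono_rel[rotated]) (use mem xs Suc.prems(1) in auto)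
  then show ?case
    using sub ys(2) mem xs
    by (intro exI[of _ "x # ys"] exI[of _ "h(x := c)"]) auto
qed

text \<open>Pigeonhole on the colours \<open>h\<close> of the first entries of an end-homogeneous
  list of length \<open>CARD('c) * n\<close>.\<close>

lemma ramsey_pairs:
  fixes f :: "'a \<Rightarrow> 'a \<Rightarrow> 'c::finite"
  assumes "CARD('c) \<ge> 2" "distinct xs" "length xs \<ge> CARD('c) ^ (CARD('c) * n)"
  shows "\<exists>ys c. subseq ys xs \<and> length ys = n \<and> sorted_wrt (\<lambda>x y. f x y = c) ys"
proof -
  obtain ys h where ys: "subseq ys xs" "length ys = CARD('c) * n"
      "sorted_wrt (\<lambda>x y. f x y = h x) ys"
    using end_homogeneous_pairs[OF assms] by blast
  obtain c where "length ys \<le> CARD('c) * length (filter (\<lambda>x. h x = c) ys)"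
    using pigeonhole_list by metis
  then have n: "n \<le> length (filter (\<lambda>x. h x = c) ys)" (is "_ \<le> length ?zs")
    using ys(2) by simp
  have "sorted_wrt (\<lambda>x y. f x y = h x) ?zs"
    using ys(3) by (rule sorted_wrt_filter)
  then have "sorted_wrt (\<lambda>x y. f x y = c) ?zs"
    by (rule sorted_wrt_mono_rel[rotated]) auto
  then have "sorted_wrt (\<lambda>x y. f x y = c) (take n ?zs)"
    by (rule sorted_wrt_take)
  moreover have "subseq (take n ?zs) xs"
    by (meson prefix_imp_subseq subseq_filter_left subseq_order.trans take_is_prefix ys(1))
  ultimately show ?thesis using n by (intro exI[of _ "take n ?zs"]) auto
qed

fun triples_wrt :: "('a \<Rightarrow> 'a \<Rightarrow> 'a \<Rightarrow> bool) \<Rightarrow> 'a list \<Rightarrow> bool" where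
  "triples_wrt R [] = True"
| "triples_wrt R (x # xs) = (sorted_wrt (R x) xs \<and> triples_wrt R xs)"

lemma sorted_wrt_subseq: "subseq xs ys \<Longrightarrow> sorted_wrt R ys \<Longrightarrow> sorted_wrt R xs"
  by (induction rule: list_emb.induct) (auto dest: set_mono_subseq)

lemma triples_wrt_subseq: "subseq xs ys \<Longrightarrow> triples_wrt R ys \<Longrightarrow> triples_wrt R xs"
  by (induction rule: list_emb.induct) (auto intro: sorted_wrt_subseq)

lemma triples_wrt_nth:
  "triples_wrt R xs \<Longrightarrow> i < j \<Longrightarrow> j < k \<Longrightarrow> k < length xs \<Longrightarrow> R (xs ! i) (xs ! j) (xs ! k)"
proof (induction xs arbitrary: i j k)
  case (Cons x xs)
  then show ?case
    by (cases i; cases j; cases k) (auto simp: sorted_wrt_iff_nth_less)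
qed simp

text \<open>\<open>Y\<close> holds the points chosen earlier. The next point \<open>x\<close> comes
  from \<open>A\<close>, and \<open>A\<close> shrinks to points \<open>z\<close> on which every
  colour \<open>f y x z\<close> with \<open>y\<close> in \<open>Y\<close> is constant. This costs a
  factor \<open>CARD('c) ^ card Y\<close> per step, so the exponent is quadratic in
  \<open>t\<close>.\<close>

lemma end_homogeneous_triples:
  fixes f :: "'a \<Rightarrow> 'a \<Rightarrow> 'a \<Rightarrow> 'c::finite"
  assumes "CARD('c) \<ge> 2" "finite Y" "finite A" "card A \<ge> CARD('c) ^ (t * (card Y + t))"
  shows "\<exists>xs h. distinct xs \<and> set xs \<subseteq> A \<and> length xs = t \<and>
           (\<forall>y\<in>Y. sorted_wrt (\<lambda>x z. f y x z = h y x) xs) \<and>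
           triples_wrt (\<lambda>x y z. f x y z = h x y) xs"
  using assms(2-4)
proof (induction t arbitrary: A Y)
  case 0
  then show ?case by (intro exI[of _ "[]"]) auto
next
  case (Suc t)
  let ?q = "CARD('c)" and ?s = "card Y"
  let ?b = "?q ^ (t * (Suc ?s + t))"
  have q0: "?q > 0" using assms(1) by linarith
  have bound: "Suc (?q ^ ?s * ?b) \<le> card A"
  proof -
    \<comment> \<open>The three summands pay for the pigeonhole over colour vectors, for the
      induction hypothesis with \<open>x\<close> added to \<open>Y\<close>, and, since the last
      power is at least 2, for removing \<open>x\<close> from \<open>A\<close>.\<close>
    have "Suc t * (?s + Suc t) = ?s + t * (Suc ?s + t) + Suc t" by (simp add: algebra_simps)
    then have "?q ^ (Suc t * (?s + Suc t)) = ?q ^ ?s * ?b * ?q ^ Suc t"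
      by (simp only: power_add)
    moreover have "?q ^ Suc t \<ge> 2"
      using assms(1) self_le_power[of ?q "Suc t"] by linarith
    moreover have "?q ^ ?s * ?b \<ge> 1" using q0 by (simp add: Suc_le_eq)
    ultimately have "?q ^ (Suc t * (?s + Suc t)) \<ge> ?q ^ ?s * ?b * 2"
      by (metis mult_le_mono2)
    with \<open>?q ^ ?s * ?b \<ge> 1\<close> Suc.prems(3) show ?thesis by linarith
  qed
  then obtain x where x: "x \<in> A" by fastforce
  define A0 where "A0 = (A - {x})"
  define F where "F = (\<lambda>z. \<lambda>y\<in>Y. f y x z)"
  have fin: "finite A0" using Suc.prems A0_def by simp
  have A0: "?q ^ ?s * ?b \<le> card A0"
    using bound x Suc.prems by (simp add: A0_def)
  have "F \<in> A0 \<rightarrow> (Y \<rightarrow>\<^sub>E (UNIV :: 'c set))" by (auto simp: F_def)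
  moreover have cardF: "card (Y \<rightarrow>\<^sub>E (UNIV :: 'c set)) = ?q ^ ?s"
    using Suc.prems(1) by (simp add: card_PiE)
  moreover have "finite (Y \<rightarrow>\<^sub>E (UNIV :: 'c set))" "Y \<rightarrow>\<^sub>E (UNIV :: 'c set) \<noteq> {}"
    using Suc.prems(1) by (auto intro!: finite_PiE simp: PiE_eq_empty_iff)
  ultimately obtain g where g: "card A0 \<le> card (F -` {g} \<inter> A0) * ?q ^ ?s"
    using pigeonhole_card[of F A0 "Y \<rightarrow>\<^sub>E (UNIV :: 'c set)"] fin by auto
  define B where "B = F -` {g} \<inter> A0"
  have "?q ^ ?s * ?b \<le> ?q ^ ?s * card B"
    using le_trans[OF A0 g] by (simp add: B_def ac_simps)
  then have "?b \<le> card B" using q0 by (simp only: mult_le_cancel1 zero_less_power)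
  moreover have "finite B" using fin B_def by simp
  \<comment> \<open>Only an inequality: \<open>Y\<close> and \<open>A\<close> may overlap, so
    \<open>x\<close> can already lie in \<open>Y\<close>.\<close>
  moreover have "?q ^ (t * (card (insert x Y) + t)) \<le> ?b"
    using Suc.prems(1) q0
    by (intro power_increasing mult_le_mono2 add_right_mono) (auto simp: card_insert_if)
  ultimately have "\<exists>xs h. distinct xs \<and> set xs \<subseteq> B \<and> length xs = t \<and>
           (\<forall>y\<in>insert x Y. sorted_wrt (\<lambda>x z. f y x z = h y x) xs) \<and>
           triples_wrt (\<lambda>x y z. f x y z = h x y) xs"
    using Suc.prems(1) by (intro Suc.IH) auto
  then obtain xs h where xs: "distinct xs" "set xs \<subseteq> B" "length xs = t"
      "\<forall>y\<in>insert x Y. sorted_wrt (\<lambda>x z. f y x z = h y x) xs"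
      "triples_wrt (\<lambda>x y z. f x y z = h x y) xs"
    by blast
  \<comment> \<open>The vector \<open>g\<close> gives the colours of triples with middle point
    \<open>x\<close>. Since \<open>x\<close> is not in \<open>xs\<close>, the colours inside
    \<open>xs\<close> are still described by \<open>h'\<close>.\<close>
  define h' where "h' = (\<lambda>y z. if z = x then g y else h y z)"
  have xn: "x \<notin> set xs" using xs(2) by (auto simp: B_def A0_def)
  have h': "h' y u = h y u" if "u \<noteq> x" for y u using that by (simp add: h'_def)
  have *: "sorted_wrt (\<lambda>u z. f y u z = h' y u) xs" if "y \<in> insert x Y" for y
  proof -
    have "sorted_wrt (\<lambda>u z. f y u z = h y u) xs" using xs(4) that by blast
    then show ?thesis
      by (rule sorted_wrt_mono_rel[rotated]) (metis h' xn)
  qed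
  have tr: "triples_wrt (\<lambda>x y z. f x y z = h' x y) zs"
    if "triples_wrt (\<lambda>x y z. f x y z = h x y) zs" "x \<notin> set zs" for zs
    using that
  proof (induction zs)
    case (Cons u zs)
    then have "sorted_wrt (\<lambda>y z. f u y z = h u y) zs" "x \<notin> set zs" by auto
    then have "sorted_wrt (\<lambda>y z. f u y z = h' u y) zs"
      by (elim sorted_wrt_mono_rel[rotated]) (metis h')
    with Cons show ?case by simp
  qed simp
  have "f y x z = h' y x" if "y \<in> Y" "z \<in> set xs" for y z
    using that xs(2) by (auto simp: h'_def B_def F_def)
  then show ?case
    using xs xn x * tr[OF xs(5) xn]
    by (intro exI[of _ "x # xs"] exI[of _ h']) (auto simp: B_def A0_def)
qed

text \<open>Starting from \<open>Y = {}\<close>, build a list of length \<open>t\<close> in which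
  the first two points of a triple fix its colour, then apply \<open>ramsey_pairs\<close> to that
  colouring \<open>h\<close> of pairs. The exponent is the square of the bound for pairs.\<close>

theorem erdos_rado_triples:
  fixes f :: "'a \<Rightarrow> 'a \<Rightarrow> 'a \<Rightarrow> 'c::finite"
  assumes "CARD('c) \<ge> 2" "finite A" "card A \<ge> CARD('c) ^ ((CARD('c) ^ (CARD('c) * n))\<^sup>2)"
  obtains xs c where "distinct xs" "set xs \<subseteq> A" "length xs = n"
    "\<And>i j k. i < j \<Longrightarrow> j < k \<Longrightarrow> k < n \<Longrightarrow> f (xs ! i) (xs ! j) (xs ! k) = c"
proof -
  define t where "t = CARD('c) ^ (CARD('c) * n)"
  obtain ys h where ys: "distinct ys" "set ys \<subseteq> A" "length ys = t"
      "triples_wrt (\<lambda>x y z. f x y z = h x y) ys"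
    using end_homogeneous_triples[of "{}" A t f] assms by (auto simp: t_def power2_eq_square)
  obtain xs c where xs: "subseq xs ys" "length xs = n" "sorted_wrt (\<lambda>x y. h x y = c) xs"
    using ramsey_pairs[OF assms(1) ys(1), of n h] ys(3) by (auto simp: t_def)
  have "triples_wrt (\<lambda>x y z. f x y z = h x y) xs"
    using triples_wrt_subseq xs(1) ys(4) by blast
  then have "f (xs ! i) (xs ! j) (xs ! k) = c" if "i < j" "j < k" "k < n" for i j k
    using triples_wrt_nth[of "\<lambda>x y z. f x y z = h x y" xs i j k] that xs(2,3)
    by (auto simp: sorted_wrt_iff_nth_less)
  moreover have "distinct xs" "set xs \<subseteq> A"
    using distinct_subseq[OF xs(1)] set_mono_subseq[OF xs(1)] ys(1,2) by auto
  ultimately show ?thesis using that xs(2) by blast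
qed

section \<open>Orientation and convex position\<close>

text \<open>Twice the signed area of the triangle, positive for a left turn.\<close>

definition orient :: "real ^ 2 \<Rightarrow> real ^ 2 \<Rightarrow> real ^ 2 \<Rightarrow> real" where
  "orient p q r = (q $ 1 - p $ 1) * (r $ 2 - p $ 2) - (q $ 2 - p $ 2) * (r $ 1 - p $ 1)"

lemma collinear_iff_orient: "collinear {a, b, c} \<longleftrightarrow> orient a b c = 0"
proof
  assume "collinear {a, b, c}"
  then consider "a = c" | u where "b = u *\<^sub>R a + (1 - u) *\<^sub>R c"
    by (auto simp: collinear_3_expand)
  then show "orient a b c = 0"
  proof cases
    case 2
    show ?thesis unfolding 2 by (simp add: orient_def algebra_simps)
  qed (simp add: orient_def)
next
  assume *: "orient a b c = 0"
  show "collinear {a, b, c}"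
  proof (cases "a = c")
    case False
    then consider "a $ 1 \<noteq> c $ 1" | "a $ 2 \<noteq> c $ 2"
      by (auto simp: vec_eq_iff forall_2)
    then have "\<exists>u. b = u *\<^sub>R a + (1 - u) *\<^sub>R c"
    proof cases
      case 1
      define u where "u = (b $ 1 - c $ 1) / (a $ 1 - c $ 1)"
      have u: "u * (a $ 1 - c $ 1) = b $ 1 - c $ 1" using 1 by (simp add: u_def)
      have "(b $ 2 - c $ 2) * (a $ 1 - c $ 1) = (b $ 1 - c $ 1) * (a $ 2 - c $ 2)"
        using * unfolding orient_def by (simp add: algebra_simps)
      also have "\<dots> = (u * (a $ 2 - c $ 2)) * (a $ 1 - c $ 1)"
        unfolding u[symmetric] by simp
      finally have "b $ 2 - c $ 2 = u * (a $ 2 - c $ 2)" using 1 by simp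
      then show ?thesis using u
        by (intro exI[of _ u]) (simp add: vec_eq_iff forall_2 algebra_simps)
    next
      case 2
      define u where "u = (b $ 2 - c $ 2) / (a $ 2 - c $ 2)"
      have u: "u * (a $ 2 - c $ 2) = b $ 2 - c $ 2" using 2 by (simp add: u_def)
      have "(b $ 1 - c $ 1) * (a $ 2 - c $ 2) = (b $ 2 - c $ 2) * (a $ 1 - c $ 1)"
        using * unfolding orient_def by (simp add: algebra_simps)
      also have "\<dots> = (u * (a $ 1 - c $ 1)) * (a $ 2 - c $ 2)"
        unfolding u[symmetric] by simp
      finally have "b $ 1 - c $ 1 = u * (a $ 1 - c $ 1)" using 2 by simp
      then show ?thesis using u
        by (intro exI[of _ u]) (simp add: vec_eq_iff forall_2 algebra_simps)
    qed
    then show ?thesis by (auto simp: collinear_3_expand)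
  qed (simp add: collinear_3_expand)
qed

lemma orient_cyclic: "orient p q r = orient q r p"
  by (simp add: orient_def algebra_simps)

lemma orient_affine:
  assumes "u + v = 1"
  shows "orient r p (u *\<^sub>R x + v *\<^sub>R y) = u * orient r p x + v * orient r p y"
proof -
  have u: "u = 1 - v" using assms by simp
  show ?thesis unfolding u by (simp add: orient_def algebra_simps)
qed

text \<open>A segment from the boundary point \<open>r\<close> into the open half-plane leaves the
  boundary line at once. The sign of \<open>s\<close> selects the side.\<close>

lemma convex_insert_open_halfplane: "convex (insert r {q. s * orient r p q > 0})"
proof (rule convexI)
  fix x y and u v :: real
  assume xy: "x \<in> insert r {q. s * orient r p q > 0}" "y \<in> insert r {q. s * orient r p q > 0}"
    and uv: "0 \<le> u" "0 \<le> v" "u + v = 1"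
  have r: "orient r p r = 0" by (simp add: orient_def)
  have eq: "s * orient r p (u *\<^sub>R x + v *\<^sub>R y) = u * (s * orient r p x) + v * (s * orient r p y)"
    using orient_affine[OF uv(3)] by (simp add: algebra_simps)
  have nonneg: "s * orient r p x \<ge> 0" "s * orient r p y \<ge> 0" using xy r by auto
  consider "x = r" "y = r" | "u = 0" | "v = 0"
    | "s * orient r p x > 0" "u > 0" | "s * orient r p y > 0" "v > 0"
    using xy uv by (metis insertE less_le mem_Collect_eq)
  then show "u *\<^sub>R x + v *\<^sub>R y \<in> insert r {q. s * orient r p q > 0}"
  proof cases
    case 1
    then show ?thesis using uv by (simp flip: scaleR_add_left)
  next
    case 4
    then have "u * (s * orient r p x) > 0" by simp
    then show ?thesis using nonneg uv eq by (simp add: add_pos_nonneg)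
  next
    case 5
    then have "v * (s * orient r p y) > 0" by simp
    then show ?thesis using nonneg uv eq by (simp add: add_nonneg_pos)
  qed (use xy uv in auto)
qed

text \<open>In the cyclic order of the list, all other points lie strictly on one side of the line through a point and its predecessor.\<close>
lemma convex_position_of_oriented_list:
  assumes "distinct xs"
    and "\<And>i j k. i < j \<Longrightarrow> j < k \<Longrightarrow> k < length xs \<Longrightarrow> s * orient (xs ! i) (xs ! j) (xs ! k) > 0"
  shows "convex_position (set xs)"
  unfolding convex_position_def
proof
  fix p assume "p \<in> set xs"
  then obtain j where j: "j < length xs" "p = xs ! j" by (metis in_set_conv_nth)
  \<comment> \<open>The cyclic predecessor of \<open>j\<close>. It equals \<open>j\<close> only for
    a list of one point, which is treated separately.\<close>
  define i where "i = (if j = 0 then length xs - 1 else j - 1)"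
  define r where "r = xs ! i"
  have i: "i < length xs" using j by (auto simp: i_def)
  show "p \<notin> convex hull (set xs - {p})"
  proof (cases "length xs = 1")
    case True
    then have "set xs - {p} = {}" using j by (auto simp: length_Suc_conv)
    then show ?thesis by (simp only: convex_hull_empty empty_iff not_False_eq_True)
  next
    case False
    then have "i \<noteq> j" using j by (auto simp: i_def)
    then have "r \<noteq> p" using assms(1) i j by (simp add: r_def nth_eq_iff_index_eq)
    have "s * orient r p (xs ! k) > 0" if k: "k < length xs" "k \<noteq> i" "k \<noteq> j" for k
    proof -
      consider "j = 0" "0 < k" "k < i" | "j > 0" "j < k" | "j > 0" "k < i"
        using k j by (force simp: i_def)
      then show ?thesis
      proof cases
        case 1
        then show ?thesis using assms(2)[of 0 k i] i j orient_cyclic[of r p "xs ! k"]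
          by (simp add: r_def)
      next
        case 2
        then show ?thesis using assms(2)[of i j k] k j by (simp add: r_def i_def)
      next
        case 3
        then show ?thesis using assms(2)[of k i j] j orient_cyclic[of "xs ! k" r p]
          by (simp add: r_def i_def)
      qed
    qed
    then have "set xs - {p} \<subseteq> insert r {q. s * orient r p q > 0}"
      using j by (fastforce simp: r_def in_set_conv_nth)
    then have "convex hull (set xs - {p}) \<subseteq> insert r {q. s * orient r p q > 0}"
      by (intro hull_minimal convex_insert_open_halfplane)
    moreover have "orient r p p = 0" by (simp add: orient_def)
    ultimately show ?thesis using \<open>r \<noteq> p\<close> by auto
  qed
qed

text \<open>Turns orientation into vertical position: \<open>w\<close> is the point of the chord
  from \<open>a\<close> to \<open>c\<close> on the vertical line through \<open>b\<close>, and the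
  sign tells whether the chord passes above or below \<open>b\<close>.\<close>

lemma chord_at:
  assumes "convex C" "a \<in> C" "c \<in> C" "a $ 1 \<le> b $ 1" "b $ 1 \<le> c $ 1" "a $ 1 < c $ 1"
  obtains w where "w \<in> C" "w $ 1 = b $ 1" "orient a b c = (w $ 2 - b $ 2) * (c $ 1 - a $ 1)"
proof -
  define t where "t = (b $ 1 - a $ 1) / (c $ 1 - a $ 1)"
  have t: "0 \<le> t" "t \<le> 1" "t * (c $ 1 - a $ 1) = b $ 1 - a $ 1"
    using assms by (auto simp: t_def)
  define w where "w = (1 - t) *\<^sub>R a + t *\<^sub>R c"
  have "w \<in> C" using assms t by (auto simp: w_def convex_alt)
  moreover have "w $ 1 = b $ 1" using t(3) by (simp add: w_def algebra_simps)
  moreover have "orient a b c = (w $ 2 - b $ 2) * (c $ 1 - a $ 1)"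
  proof -
    have w2: "w $ 2 = a $ 2 + t * (c $ 2 - a $ 2)" by (simp add: w_def algebra_simps)
    have "(w $ 2 - b $ 2) * (c $ 1 - a $ 1) =
        (a $ 2 - b $ 2) * (c $ 1 - a $ 1) + (t * (c $ 1 - a $ 1)) * (c $ 2 - a $ 2)"
      unfolding w2 by (simp add: algebra_simps)
    then show ?thesis unfolding t(3) by (simp add: orient_def algebra_simps)
  qed
  ultimately show ?thesis using that by blast
qed

lemma convex_vertical:
  fixes b :: "real ^ 2"
  assumes "convex C" "v \<in> C" "w \<in> C" "v $ 1 = b $ 1" "w $ 1 = b $ 1" "v $ 2 \<le> b $ 2" "b $ 2 \<le> w $ 2"
  shows "b \<in> C"
proof (cases "v $ 2 = w $ 2")
  case True
  then have "b = v" using assms by (auto simp: vec_eq_iff forall_2)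
  then show ?thesis using assms by simp
next
  case False
  define t where "t = (b $ 2 - v $ 2) / (w $ 2 - v $ 2)"
  have t: "0 \<le> t" "t \<le> 1" "t * (w $ 2 - v $ 2) = b $ 2 - v $ 2"
    using assms False by (auto simp: t_def)
  have "(1 - t) *\<^sub>R v + t *\<^sub>R w \<in> C" using assms t by (auto simp: convex_alt)
  moreover have "(1 - t) *\<^sub>R v + t *\<^sub>R w = b"
    using t(3) assms by (auto simp: vec_eq_iff forall_2 algebra_simps)
  ultimately show ?thesis by simp
qed

text \<open>If the chords from \<open>l\<close> to \<open>r\<close> and from \<open>a\<close> to
  \<open>c\<close> passed on different sides of \<open>b\<close>, then \<open>b\<close> would lie
  between two points of the hull of \<open>S - {b}\<close> on a vertical line, hence in that
  hull.\<close>

lemma convex_position_chain: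
  assumes "convex_position S" "l \<in> S" "r \<in> S" "\<And>p. p \<in> S \<Longrightarrow> l $ 1 \<le> p $ 1 \<and> p $ 1 \<le> r $ 1"
    and "a \<in> S" "b \<in> S" "c \<in> S" "a $ 1 < b $ 1" "b $ 1 < c $ 1"
  shows "orient l b r \<le> 0 \<Longrightarrow> orient a b c \<le> 0" "orient l b r \<ge> 0 \<Longrightarrow> orient a b c \<ge> 0"
proof -
  let ?C = "convex hull (S - {b})"
  have b: "b \<notin> ?C" using assms by (auto simp: convex_position_def)
  have lr: "l $ 1 < b $ 1" "b $ 1 < r $ 1" using assms by force+
  have C: "a \<in> ?C" "c \<in> ?C" "l \<in> ?C" "r \<in> ?C"
    using assms lr by (auto intro!: hull_inc)
  obtain w where w: "w \<in> ?C" "w $ 1 = b $ 1" "orient a b c = (w $ 2 - b $ 2) * (c $ 1 - a $ 1)"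
    using chord_at[OF convex_convex_hull C(1,2), of b] assms by auto
  obtain v where v: "v \<in> ?C" "v $ 1 = b $ 1" "orient l b r = (v $ 2 - b $ 2) * (r $ 1 - l $ 1)"
    using chord_at[OF convex_convex_hull C(3,4), of b] lr by auto
  have "\<not> (v $ 2 \<le> b $ 2 \<and> b $ 2 \<le> w $ 2)" "\<not> (w $ 2 \<le> b $ 2 \<and> b $ 2 \<le> v $ 2)"
    using convex_vertical[OF convex_convex_hull v(1) w(1), of b]
      convex_vertical[OF convex_convex_hull w(1) v(1), of b] b v(2) w(2) by blast+
  moreover have "c $ 1 - a $ 1 > 0" "r $ 1 - l $ 1 > 0" using assms lr by auto
  ultimately show "orient l b r \<le> 0 \<Longrightarrow> orient a b c \<le> 0" "orient l b r \<ge> 0 \<Longrightarrow> orient a b c \<ge> 0"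
    unfolding w(3) v(3) by (auto simp: mult_le_0_iff zero_le_mult_iff)
qed

text \<open>The chord from a leftmost to a rightmost point divides \<open>S\<close>. The points on
  or above it form a cap, those on or below it a cup, and one of the two has at least half of the
  points.\<close>

lemma convex_position_large_cup_or_cap:
  assumes "finite S" "convex_position S"
  obtains U where "U \<subseteq> S" "card S \<le> 2 * card U"
    "(\<forall>a\<in>U. \<forall>b\<in>U. \<forall>c\<in>U. a $ 1 < b $ 1 \<longrightarrow> b $ 1 < c $ 1 \<longrightarrow> orient a b c \<le> 0) \<or>
     (\<forall>a\<in>U. \<forall>b\<in>U. \<forall>c\<in>U. a $ 1 < b $ 1 \<longrightarrow> b $ 1 < c $ 1 \<longrightarrow> orient a b c \<ge> 0)"
proof (cases "S = {}")
  case True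
  then show ?thesis using that[of "{}"] by simp
next
  case False
  obtain l where l: "l \<in> S" "\<And>p. p \<in> S \<Longrightarrow> l $ 1 \<le> p $ 1"
    using ex_is_arg_min_if_finite[OF assms(1) False, of "\<lambda>p. p $ 1"]
    by (auto simp: is_arg_min_linorder)
  obtain r where r: "r \<in> S" "\<And>p. p \<in> S \<Longrightarrow> p $ 1 \<le> r $ 1"
    using ex_is_arg_min_if_finite[OF assms(1) False, of "\<lambda>p. - p $ 1"]
    by (auto simp: is_arg_min_linorder)
  define U where "U = {p \<in> S. orient l p r \<le> 0}"
  define L where "L = {p \<in> S. orient l p r \<ge> 0}"
  have "card S \<le> card U + card L"
  proof -
    have "S = U \<union> L" by (auto simp: U_def L_def)
    then show ?thesis by (metis card_Un_le)
  qed
  then consider "card S \<le> 2 * card U" | "card S \<le> 2 * card L" by linarith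
  then show ?thesis
  proof cases
    case 1
    have "\<forall>a\<in>U. \<forall>b\<in>U. \<forall>c\<in>U. a $ 1 < b $ 1 \<longrightarrow> b $ 1 < c $ 1 \<longrightarrow> orient a b c \<le> 0"
      using convex_position_chain(1)[OF assms(2) l(1) r(1)] l r by (auto simp: U_def)
    then show ?thesis using that[of U] 1 by (auto simp: U_def)
  next
    case 2
    have "\<forall>a\<in>L. \<forall>b\<in>L. \<forall>c\<in>L. a $ 1 < b $ 1 \<longrightarrow> b $ 1 < c $ 1 \<longrightarrow> orient a b c \<ge> 0"
      using convex_position_chain(2)[OF assms(2) l(1) r(1)] l r by (auto simp: L_def)
    then show ?thesis using that[of L] 2 by (auto simp: L_def)
  qed
qed

section \<open>The doubly exponential upper bound\<close>

lemma convex_ramsey_upper: "convex_ramsey n (4 ^ ((4 ^ (4 * n))\<^sup>2))"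
  unfolding convex_ramsey_def
proof (intro allI impI)
  fix P and col :: "(real ^ 2) set \<Rightarrow> bool"
  assume P: "finite P" "card P = 4 ^ ((4 ^ (4 * n))\<^sup>2)" "general_position P"
  \<comment> \<open>One bit suffices for the orientation, since general position excludes the value
    0.\<close>
  define f where "f = (\<lambda>p q r. (col {p, q, r}, orient p q r > 0))"
  have card4: "CARD(bool \<times> bool) = 4" by simp
  obtain xs c where xs: "distinct xs" "set xs \<subseteq> P" "length xs = n"
    and c: "\<And>i j k. i < j \<Longrightarrow> j < k \<Longrightarrow> k < n \<Longrightarrow> f (xs ! i) (xs ! j) (xs ! k) = c"
    using erdos_rado_triples[of P n f, unfolded card4] P by auto
  have col: "col {xs ! i, xs ! j, xs ! k} = fst c"
    and orient: "(orient (xs ! i) (xs ! j) (xs ! k) > 0) = snd c"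
    if "i < j" "j < k" "k < n" for i j k
    using c[OF that] by (auto simp: f_def)
  define s where "s = (if snd c then 1 else -1 :: real)"
  have "convex_position (set xs)"
  proof (rule convex_position_of_oriented_list[OF xs(1)])
    fix i j k assume ijk: "i < j" "j < k" "k < length xs"
    then have "{xs ! i, xs ! j, xs ! k} \<in> nsets P 3"
      using xs by (auto simp: nsets_def card_insert_if nth_eq_iff_index_eq)
    then have "orient (xs ! i) (xs ! j) (xs ! k) \<noteq> 0"
      using P(3) by (auto simp: general_position_def collinear_iff_orient)
    then show "s * orient (xs ! i) (xs ! j) (xs ! k) > 0"
      using orient[of i j k] ijk xs(3) by (auto simp: s_def)
  qed
  moreover have "monochromatic col (set xs)"
    unfolding monochromatic_def
  proof (intro exI ballI)
    fix T assume "T \<in> nsets (set xs) 3"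
    moreover have "set xs = (!) xs ` {..<n}" using xs(3) by (auto simp: set_conv_nth)
    \<comment> \<open>Pulling \<open>T\<close> back to indices allows its points to be listed in the
      order of \<open>xs\<close>.\<close>
    ultimately have "T \<in> nsets ((!) xs ` {..<n}) 3" by simp
    moreover have "inj_on ((!) xs) {..<n}" using xs by (intro inj_on_nth) auto
    ultimately obtain I where "I \<in> nsets {..<n} 3" "T = (!) xs ` I"
      by (rule nset_image_obtains)
    then show "col T = fst c"
      using col by (auto simp: ordered_nsets_3_eq)
  qed
  moreover have "set xs \<in> nsets P n"
    using xs by (auto simp: nsets_def distinct_card)
  ultimately show "\<exists>S\<in>nsets P n. convex_position S \<and> monochromatic col S" by blast
qed

section \<open>Graphs without homogeneous sets\<close>

lemma exists_graph_without_homogeneous_set: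
  assumes "2 * (m choose k) < 2 ^ (k choose 2)"
  obtains F :: "nat set set" where
    "\<And>D. D \<subseteq> {..<m} \<Longrightarrow> k \<le> card D \<Longrightarrow> \<not> nsets D 2 \<subseteq> F \<and> nsets D 2 \<inter> F \<noteq> {}"
proof - \<comment> \<open>Erdos' union bound over the graphs \<open>F\<close> on \<open>{..<m}\<close>\<close>
  define E where "E = nsets {..<m} 2"
  define K where "K = nsets {..<m} k"
  let ?bad1 = "\<lambda>D. {F \<in> Pow E. nsets D 2 \<subseteq> F}" and ?bad2 = "\<lambda>D. {F \<in> Pow E. nsets D 2 \<inter> F = {}}"
  have fin: "finite E" "finite K" by (simp_all add: E_def K_def finite_imp_finite_nsets)
  \<comment> \<open>In either kind of bad graph only the edges outside \<open>nsets D 2\<close> are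
    free. The count is multiplied out to avoid subtraction in the exponent.\<close>
  have bad: "card (?bad1 D \<union> ?bad2 D) * 2 ^ (k choose 2) \<le> 2 * 2 ^ card E" if "D \<in> K" for D
  proof -
    let ?Q = "nsets D 2"
    have Q: "?Q \<subseteq> E" "card ?Q = k choose 2"
      using that nsets_mono[of D "{..<m}" 2] by (auto simp: K_def E_def nsets_def[of _ k])
    have bad1: "?bad1 D = (\<lambda>G. G \<union> ?Q) ` Pow (E - ?Q)"
    proof -
      have "F \<in> (\<lambda>G. G \<union> ?Q) ` Pow (E - ?Q)" if "F \<in> ?bad1 D" for F
        using that by (intro image_eqI[of _ _ "F - ?Q"]) auto
      then show ?thesis using Q(1) by blast
    qed
    then have "card (?bad1 D) \<le> card (Pow (E - ?Q))"
      unfolding bad1 using fin by (intro card_image_le) simp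
    moreover have "?bad2 D = Pow (E - ?Q)" by auto
    moreover have pow: "card (Pow (E - ?Q)) * 2 ^ (k choose 2) = 2 ^ card E"
      using fin Q card_mono[OF fin(1) Q(1)]
      by (simp add: card_Pow card_Diff_subset finite_subset flip: power_add)
    moreover have "card (?bad1 D \<union> ?bad2 D) \<le> card (?bad1 D) + card (?bad2 D)"
      by (rule card_Un_le)
    ultimately have "card (?bad1 D \<union> ?bad2 D) \<le> 2 * card (Pow (E - ?Q))" by simp
    then have "card (?bad1 D \<union> ?bad2 D) * 2 ^ (k choose 2)
        \<le> 2 * card (Pow (E - ?Q)) * 2 ^ (k choose 2)"
      by (rule mult_le_mono1)
    then show ?thesis by (simp only: mult.assoc pow)
  qed
  have "card (\<Union>D\<in>K. ?bad1 D \<union> ?bad2 D) * 2 ^ (k choose 2)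
      \<le> (\<Sum>D\<in>K. card (?bad1 D \<union> ?bad2 D)) * 2 ^ (k choose 2)"
    by (intro mult_le_mono1 card_UN_le fin)
  also have "\<dots> \<le> (\<Sum>D\<in>K. 2 * 2 ^ card E)"
    unfolding sum_distrib_right by (intro sum_mono bad)
  also have "\<dots> = 2 * (m choose k) * 2 ^ card E" by (simp add: K_def)
  also have "\<dots> < 2 ^ (k choose 2) * 2 ^ card E"
    using assms by (intro mult_strict_right_mono) auto
  finally have "card (\<Union>D\<in>K. ?bad1 D \<union> ?bad2 D) < card (Pow E)"
    using fin by (simp add: card_Pow)
  moreover have "finite (\<Union>D\<in>K. ?bad1 D \<union> ?bad2 D)" using fin by auto
  ultimately obtain F where F: "F \<in> Pow E" "F \<notin> (\<Union>D\<in>K. ?bad1 D \<union> ?bad2 D)"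
    by (meson card_mono not_le subsetI)
  show ?thesis
  proof (rule that)
    fix D assume D: "D \<subseteq> {..<m}" "k \<le> card D"
    then obtain D' where D': "D' \<subseteq> D" "card D' = k" "finite D'"
      by (metis obtain_subset_with_card_n)
    then have "D' \<in> K" using D by (auto simp: K_def nsets_def)
    then have "\<not> nsets D' 2 \<subseteq> F \<and> nsets D' 2 \<inter> F \<noteq> {}" using F by blast
    then show "\<not> nsets D 2 \<subseteq> F \<and> nsets D 2 \<inter> F \<noteq> {}"
      using nsets_mono[OF D'(1), of 2] by blast
  qed
qed

text \<open>In base 2 the left side has exponent at most \<open>4 * r^2 + 1\<close>, the right side
  \<open>8 * r^2 - 2 * r\<close>. If \<open>4 * r > 2 ^ r\<close>, the left side is 0.\<close>

lemma choose_power2_less: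
  assumes "r \<ge> 1"
  shows "2 * (2 ^ r choose (4 * r)) < (2::nat) ^ ((4 * r) choose 2)"
proof -
  have "2 * (2 ^ r choose (4 * r)) \<le> 2 * (2 ^ r) ^ (4 * r)"
    by (cases "4 * r \<le> 2 ^ r") (auto intro: binomial_le_pow simp: binomial_eq_0)
  also have "\<dots> = (2::nat) ^ (1 + r * (4 * r))" by (simp add: power_mult)
  also have "\<dots> < (2::nat) ^ ((4 * r) choose 2)"
  proof (rule power_strict_increasing)
    have "(4 * r) choose 2 = 8 * (r * r) - 2 * r"
      by (simp add: choose_two diff_mult_distrib2 algebra_simps)
    moreover have "r \<le> r * r" using assms by simp
    moreover have "r * (4 * r) = 4 * (r * r)" by simp
    ultimately show "1 + r * (4 * r) < (4 * r) choose 2" using assms by linarith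
  qed simp
  finally show ?thesis .
qed

section \<open>The stepping-up point set\<close>

text \<open>The delta function of the stepping-up lemma: the highest binary digit in which two
  numbers differ. Meaningful only for distinct finite sets.\<close>

definition top_diff :: "nat set \<Rightarrow> nat set \<Rightarrow> nat" where
  "top_diff A B = Max (A - B \<union> (B - A))"

lemma top_diff_commute: "top_diff A B = top_diff B A"
  by (simp add: top_diff_def Un_commute)

lemma top_diff:
  assumes "finite A" "finite B" "A \<noteq> B"
  shows "(top_diff A B \<in> A) \<noteq> (top_diff A B \<in> B)"
    and "\<And>j. j > top_diff A B \<Longrightarrow> j \<in> A \<longleftrightarrow> j \<in> B"
proof -
  let ?D = "A - B \<union> (B - A)"
  have D: "finite ?D" "?D \<noteq> {}" using assms by auto
  show "(top_diff A B \<in> A) \<noteq> (top_diff A B \<in> B)"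
    using Max_in[OF D] by (auto simp: top_diff_def)
  show "j \<in> A \<longleftrightarrow> j \<in> B" if "j > top_diff A B" for j
    using Max_ge[OF D(1), of j] that by (auto simp: top_diff_def)
qed

lemma top_diff_eqI:
  assumes "finite A" "finite B" "(i \<in> A) \<noteq> (i \<in> B)" "\<And>j. j > i \<Longrightarrow> j \<in> A \<longleftrightarrow> j \<in> B"
  shows "top_diff A B = i"
  unfolding top_diff_def using assms by (intro Max_eqI) (auto simp: not_less[symmetric])

text \<open>At and above \<open>top_diff B C\<close> the sets \<open>A\<close> and \<open>B\<close>
  agree, so \<open>A\<close> first departs from \<open>C\<close> where \<open>B\<close>
  does.\<close>

lemma top_diff_ultrametric:
  assumes "finite A" "finite B" "finite C" "A \<noteq> B" "B \<noteq> C" "top_diff A B < top_diff B C"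
  shows "top_diff A C = top_diff B C"
  using top_diff[OF assms(1,2,4)] top_diff[OF assms(2,3,5)] assms
  by (intro top_diff_eqI) (auto dest: less_trans)

section \<open>Planar points from base \<open>K\<close> expansions with digits 0 and 1\<close>

definition digit_sum :: "real \<Rightarrow> nat set \<Rightarrow> real" where
  "digit_sum K A = (\<Sum>i\<in>A. K ^ i)"

lemma digit_sum_low:
  assumes "K \<ge> 4" "A \<subseteq> {..<i}"
  shows "0 \<le> digit_sum K A" "digit_sum K A \<le> K ^ i / 3"
proof -
  show "0 \<le> digit_sum K A" using assms by (auto simp: digit_sum_def intro!: sum_nonneg)
  have "digit_sum K A \<le> (\<Sum>j<i. K ^ j)"
    unfolding digit_sum_def using assms by (intro sum_mono2) auto
  also have "\<dots> = (K ^ i - 1) / (K - 1)" using assms by (simp add: geometric_sum)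
  also have "\<dots> \<le> K ^ i / 3"
    using assms by (intro frac_le) auto
  finally show "digit_sum K A \<le> K ^ i / 3" .
qed

lemma digit_sum_split:
  assumes "finite A"
  shows "digit_sum K A = digit_sum K (A \<inter> {..<i}) + (if i \<in> A then K ^ i else 0) + digit_sum K (A \<inter> {i<..})"
proof -
  have "A = (A \<inter> {..<i}) \<union> ((A \<inter> {i}) \<union> (A \<inter> {i<..}))" by auto
  then have "digit_sum K A = (\<Sum>j\<in>(A \<inter> {..<i}) \<union> ((A \<inter> {i}) \<union> (A \<inter> {i<..})). K ^ j)"
    by (simp add: digit_sum_def)
  also have "\<dots> = digit_sum K (A \<inter> {..<i}) + (digit_sum K (A \<inter> {i}) + digit_sum K (A \<inter> {i<..}))"
    unfolding digit_sum_def using assms by (subst sum.union_disjoint; (subst sum.union_disjoint)?) auto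
  also have "digit_sum K (A \<inter> {i}) = (if i \<in> A then K ^ i else 0)"
    by (simp add: digit_sum_def)
  finally show ?thesis by simp
qed

text \<open>Digits above the top difference cancel. Those below contribute the difference of two
  numbers between 0 and a third of the leading power, by \<open>digit_sum_low\<close>.\<close>

lemma digit_sum_diff:
  assumes "K \<ge> 4" "finite A" "finite B" "A \<noteq> B" "top_diff A B \<in> B"
  shows "\<bar>digit_sum K B - digit_sum K A - K ^ top_diff A B\<bar> \<le> K ^ top_diff A B / 3"
proof -
  let ?i = "top_diff A B"
  have "A \<inter> {?i<..} = B \<inter> {?i<..}" "?i \<notin> A"
    using top_diff[OF assms(2-4)] assms(5) by auto
  then have "digit_sum K B - digit_sum K A - K ^ ?i =
      digit_sum K (B \<inter> {..<?i}) - digit_sum K (A \<inter> {..<?i})"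
    using digit_sum_split[OF assms(2), of K ?i] digit_sum_split[OF assms(3), of K ?i] assms(5)
    by simp
  moreover have "0 \<le> digit_sum K (C \<inter> {..<?i})" "digit_sum K (C \<inter> {..<?i}) \<le> K ^ ?i / 3" for C
    using digit_sum_low[OF assms(1), of "C \<inter> {..<?i}" ?i] by auto
  ultimately show ?thesis
    by (smt (verit, best))
qed

text \<open>The error of one third cannot change the sign. The order is thus that of binary numbers,
  the same for every base \<open>K\<close> allowed here.\<close>

lemma digit_sum_less_iff:
  assumes "K \<ge> 4" "finite A" "finite B" "A \<noteq> B"
  shows "digit_sum K A < digit_sum K B \<longleftrightarrow> top_diff A B \<in> B"
proof -
  have *: "digit_sum K A < digit_sum K B"
    if "finite A" "finite B" "A \<noteq> B" "top_diff A B \<in> B" for A B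
  proof -
    have "K ^ top_diff A B > 0" using assms(1) by simp
    with digit_sum_diff[OF assms(1) that] show ?thesis by linarith
  qed
  show ?thesis
    using *[of A B] *[of B A] top_diff(1)[of A B] assms top_diff_commute[of A B] by force
qed

text \<open>
  The bases 4 and 64 make the slope between two points grow so fast with their top difference that
  the orientation of a triple only depends on the order of its consecutive top differences.
\<close>

definition binary_point :: "nat set \<Rightarrow> real ^ 2" where
  "binary_point A = vector [digit_sum 4 A, digit_sum 64 A]"

lemma binary_point_nth [simp]:
  "binary_point A $ 1 = digit_sum 4 A" "binary_point A $ 2 = digit_sum 64 A"
  by (simp_all add: binary_point_def)

lemma digit_sum_eq_iff:
  assumes "K \<ge> 4" "finite A" "finite B"
  shows "digit_sum K A = digit_sum K B \<longleftrightarrow> A = B"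
  using digit_sum_less_iff[OF assms] digit_sum_less_iff[OF assms(1,3,2)] top_diff(1)[OF assms(2,3)]
  by (metis order_less_irrefl top_diff_commute)

text \<open>The top differences are distinct because \<open>B\<close> contains the first but not the
  second. The orientation compares \<open>4 ^ i * 64 ^ j\<close> with \<open>64 ^ i * 4 ^ j\<close>,
  whose ratio is at least 16 one way or the other. The estimates between 2/3 and 4/3 of the leading
  powers lose only a factor 4.\<close>

lemma orient_binary_point:
  assumes "finite A" "finite B" "finite C"
    and "digit_sum 4 A < digit_sum 4 B" "digit_sum 4 B < digit_sum 4 C"
  shows "top_diff A B \<noteq> top_diff B C"
    and "top_diff A B < top_diff B C \<Longrightarrow> orient (binary_point A) (binary_point B) (binary_point C) > 0"
    and "top_diff A B > top_diff B C \<Longrightarrow> orient (binary_point A) (binary_point B) (binary_point C) < 0"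
proof -
  define i where "i = top_diff A B"
  define j where "j = top_diff B C"
  have ne: "A \<noteq> B" "B \<noteq> C" using assms by auto
  have i: "i \<in> B" and j: "j \<in> C"
    using digit_sum_less_iff[of 4] assms ne by (auto simp: i_def j_def)
  have "j \<notin> B" using top_diff(1)[OF assms(2,3) ne(2)] j by (simp add: j_def)
  with i show "top_diff A B \<noteq> top_diff B C" by (auto simp: i_def j_def)
  \<comment> \<open>The two consecutive edge vectors are \<open>(u, v)\<close> and
    \<open>(x, y)\<close>; their cross product is the orientation.\<close>
  define u v x y where "u = digit_sum 4 B - digit_sum 4 A" "v = digit_sum 64 B - digit_sum 64 A"
    "x = digit_sum 4 C - digit_sum 4 B" "y = digit_sum 64 C - digit_sum 64 B"
  note defs = this
  have or: "orient (binary_point A) (binary_point B) (binary_point C) = u * y - v * x"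
    by (simp add: orient_def defs algebra_simps)
  have "\<bar>u - 4 ^ i\<bar> \<le> 4 ^ i / 3" "\<bar>v - 64 ^ i\<bar> \<le> 64 ^ i / 3"
    "\<bar>x - 4 ^ j\<bar> \<le> 4 ^ j / 3" "\<bar>y - 64 ^ j\<bar> \<le> 64 ^ j / 3"
    using digit_sum_diff[of 4 A B] digit_sum_diff[of 64 A B]
      digit_sum_diff[of 4 B C] digit_sum_diff[of 64 B C] assms ne i j
    by (simp_all add: defs i_def j_def)
  then have b: "2/3 * 4 ^ i \<le> u" "u \<le> 4/3 * 4 ^ i" "2/3 * 64 ^ i \<le> v" "v \<le> 4/3 * 64 ^ i"
    "2/3 * 4 ^ j \<le> x" "x \<le> 4/3 * 4 ^ j" "2/3 * 64 ^ j \<le> y" "y \<le> 4/3 * 64 ^ j"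
    by linarith+
  have less: "4 * (64 ^ p * 4 ^ q) < 4 ^ p * (64::real) ^ q" if "p < q" for p q :: nat
  proof -
    have "q = p + Suc (q - Suc p)" using that by simp
    then obtain d where q: "q = p + Suc d" by blast
    have "(4::real) ^ d \<le> 64 ^ d" by (intro power_mono) auto
    moreover have "(4::real) ^ d > 0" by simp
    ultimately have "16 * (4::real) ^ d < 64 * 64 ^ d" by linarith
    then have "(4 ^ p * 64 ^ p) * (16 * (4::real) ^ d) < (4 ^ p * 64 ^ p) * (64 * 64 ^ d)"
      by (intro mult_strict_left_mono) auto
    then show ?thesis by (simp add: q power_add mult_ac)
  qed
  have pos: "(4::real) ^ i > 0" "(4::real) ^ j > 0" "(64::real) ^ i > 0" "(64::real) ^ j > 0" by simp_all
  have uv0: "0 \<le> u" "0 \<le> v" "0 \<le> x" "0 \<le> y" using b pos by linarith+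
  have uy: "(2/3 * 4 ^ i) * (2/3 * 64 ^ j) \<le> u * y" "u * y \<le> (4/3 * 4 ^ i) * (4/3 * 64 ^ j)"
    using uv0 pos by (intro mult_mono b; simp)+
  have vx: "(2/3 * 64 ^ i) * (2/3 * 4 ^ j) \<le> v * x" "v * x \<le> (4/3 * 64 ^ i) * (4/3 * 4 ^ j)"
    using uv0 pos by (intro mult_mono b; simp)+
  show "orient (binary_point A) (binary_point B) (binary_point C) > 0"
    if "top_diff A B < top_diff B C"
    using less[of i j] uy vx that unfolding or i_def[symmetric] j_def[symmetric] by simp
  show "orient (binary_point A) (binary_point B) (binary_point C) < 0"
    if "top_diff A B > top_diff B C"
    using less[of j i] uy vx that unfolding or i_def[symmetric] j_def[symmetric]
    by (simp add: mult.commute)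
qed

section \<open>General position and the doubly exponential lower bound\<close>

lemma top_diff_mem_Un:
  assumes "finite A" "finite B" "A \<noteq> B"
  shows "top_diff A B \<in> A \<union> B"
  using top_diff(1)[OF assms] by blast

lemma inj_on_binary_point:
  assumes "\<And>A. A \<in> V \<Longrightarrow> finite A"
  shows "inj_on binary_point V"
proof (rule inj_onI)
  fix A B assume "A \<in> V" "B \<in> V" "binary_point A = binary_point B"
  moreover from this have "digit_sum 4 A = digit_sum 4 B"
    using binary_point_nth(1) by metis
  ultimately show "A = B" using assms by (simp add: digit_sum_eq_iff)
qed

lemma general_position_binary_point:
  assumes "\<And>A. A \<in> V \<Longrightarrow> finite A"
  shows "general_position (binary_point ` V)"
  unfolding general_position_def
proof
  fix T assume "T \<in> nsets (binary_point ` V) 3"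
  then obtain I where I: "I \<in> nsets V 3" "T = binary_point ` I"
    using inj_on_binary_point[OF assms] by (rule nset_image_obtains)
  let ?X = "digit_sum 4"
  have fin: "finite A" if "A \<in> I" for A
    using that I(1) assms unfolding nsets_def by blast
  then have "inj_on ?X I" by (intro inj_onI) (simp add: digit_sum_eq_iff)
  then have "?X ` I \<in> nsets UNIV 3"
    using I(1) by (auto simp: nsets_def card_image)
  then obtain x y z where xyz: "?X ` I = {x, y, z}" "x < y" "y < z"
    by (auto simp: ordered_nsets_3_eq)
  then have "x \<in> ?X ` I" "y \<in> ?X ` I" "z \<in> ?X ` I" by simp_all
  then obtain A B C where ABC: "A \<in> I" "B \<in> I" "C \<in> I" "x = ?X A" "y = ?X B" "z = ?X C"
    by blast
  have "A \<noteq> B" "A \<noteq> C" "B \<noteq> C" using ABC xyz by auto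
  then have "{A, B, C} \<subseteq> I" "card {A, B, C} = 3" using ABC by auto
  then have "I = {A, B, C}"
    using I(1) card_subset_eq[of I "{A, B, C}"] by (auto simp: nsets_def)
  moreover have "finite A" "finite B" "finite C"
    using ABC fin by auto
  then have "orient (binary_point A) (binary_point B) (binary_point C) \<noteq> 0"
    using orient_binary_point[of A B C] ABC xyz by force
  ultimately show "\<not> collinear T"
    using I(2) by (simp add: collinear_iff_orient)
qed

text \<open>In a cup the consecutive top differences increase from left to right. With
  \<open>Z\<close> leftmost and \<open>B\<close> left of \<open>C\<close>, this and the ultrametric
  rule give \<open>top_diff Z B < top_diff B C = top_diff Z C\<close>. A cap is the mirror image,
  with \<open>Z\<close> rightmost.\<close>

lemma inj_on_top_diff_of_cup_or_cap:
  assumes "finite \<U>" "\<U> \<noteq> {}" "\<And>A. A \<in> \<U> \<Longrightarrow> finite A"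
    and "(\<forall>a\<in>binary_point ` \<U>. \<forall>b\<in>binary_point ` \<U>. \<forall>c\<in>binary_point ` \<U>.
            a $ 1 < b $ 1 \<longrightarrow> b $ 1 < c $ 1 \<longrightarrow> orient a b c \<le> 0) \<or>
         (\<forall>a\<in>binary_point ` \<U>. \<forall>b\<in>binary_point ` \<U>. \<forall>c\<in>binary_point ` \<U>.
            a $ 1 < b $ 1 \<longrightarrow> b $ 1 < c $ 1 \<longrightarrow> orient a b c \<ge> 0)"
  obtains Z where "Z \<in> \<U>" "inj_on (top_diff Z) (\<U> - {Z})"
proof -
  let ?X = "digit_sum 4"
  have X: "?X A = ?X B \<longleftrightarrow> A = B" if "A \<in> \<U>" "B \<in> \<U>" for A B
    using that assms(3) by (simp add: digit_sum_eq_iff)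
  have inj: "inj_on (top_diff Z) (\<U> - {Z})"
    if "\<And>B C. B \<in> \<U> - {Z} \<Longrightarrow> C \<in> \<U> - {Z} \<Longrightarrow> ?X B < ?X C \<Longrightarrow> top_diff Z B \<noteq> top_diff Z C" for Z
  proof (rule inj_onI)
    fix B C assume "B \<in> \<U> - {Z}" "C \<in> \<U> - {Z}" "top_diff Z B = top_diff Z C"
    then show "B = C" using that[of B C] that[of C B] X[of B C] by (metis DiffD1 linorder_neqE_linordered_idom)
  qed
  from assms(4) show ?thesis
  proof
    assume cap: "\<forall>a\<in>binary_point ` \<U>. \<forall>b\<in>binary_point ` \<U>. \<forall>c\<in>binary_point ` \<U>.
            a $ 1 < b $ 1 \<longrightarrow> b $ 1 < c $ 1 \<longrightarrow> orient a b c \<le> 0"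
    obtain Z where Z: "Z \<in> \<U>" "\<And>A. A \<in> \<U> \<Longrightarrow> ?X A \<le> ?X Z"
      using ex_is_arg_min_if_finite[OF assms(1,2), of "\<lambda>A. - ?X A"]
      by (auto simp: is_arg_min_linorder)
    show ?thesis
    proof (rule that[OF Z(1) inj])
      fix B C assume BC: "B \<in> \<U> - {Z}" "C \<in> \<U> - {Z}" "?X B < ?X C"
      have CZ: "?X C < ?X Z" using Z(2)[of C] X[of C Z] BC Z(1) by force
      have fin: "finite B" "finite C" "finite Z" using BC Z assms(3) by auto
      have "orient (binary_point B) (binary_point C) (binary_point Z) \<le> 0"
        using cap BC CZ Z(1) by auto
      then have "top_diff C Z < top_diff B C"
        using orient_binary_point[OF fin BC(3) CZ] by linarith
      then have "top_diff Z B = top_diff C B"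
        using top_diff_ultrametric[of Z C B] fin BC CZ
        by (auto simp: top_diff_commute)
      then show "top_diff Z B \<noteq> top_diff Z C"
        using \<open>top_diff C Z < top_diff B C\<close> by (simp add: top_diff_commute)
    qed
  next
    assume cup: "\<forall>a\<in>binary_point ` \<U>. \<forall>b\<in>binary_point ` \<U>. \<forall>c\<in>binary_point ` \<U>.
            a $ 1 < b $ 1 \<longrightarrow> b $ 1 < c $ 1 \<longrightarrow> orient a b c \<ge> 0"
    obtain Z where Z: "Z \<in> \<U>" "\<And>A. A \<in> \<U> \<Longrightarrow> ?X Z \<le> ?X A"
      using ex_is_arg_min_if_finite[OF assms(1,2), of ?X]
      by (auto simp: is_arg_min_linorder)
    show ?thesis
    proof (rule that[OF Z(1) inj])
      fix B C assume BC: "B \<in> \<U> - {Z}" "C \<in> \<U> - {Z}" "?X B < ?X C"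
      have ZB: "?X Z < ?X B" using Z(2)[of B] X[of Z B] BC Z(1) by force
      have fin: "finite Z" "finite B" "finite C" using BC Z assms(3) by auto
      have "orient (binary_point Z) (binary_point B) (binary_point C) \<ge> 0"
        using cup BC ZB Z(1) by auto
      then have "top_diff Z B < top_diff B C"
        using orient_binary_point[OF fin ZB BC(3)] by linarith
      moreover have "Z \<noteq> B" "B \<noteq> C" using ZB BC(3) by auto
      ultimately show "top_diff Z B \<noteq> top_diff Z C"
        using top_diff_ultrametric[of Z B C] fin by simp
    qed
  qed
qed

text \<open>
  The colour of a triple is read off from its set of top differences, which has exactly two elements.
\<close>

lemma not_convex_ramsey:
  assumes "r \<ge> 1" "n \<ge> 8 * r + 2" "N \<le> 2 ^ 2 ^ r"
  shows "\<not> convex_ramsey n N"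
proof
  assume ramsey: "convex_ramsey n N"
  obtain F :: "nat set set" where F: "\<And>D. D \<subseteq> {..<2 ^ r} \<Longrightarrow> 4 * r \<le> card D \<Longrightarrow>
      \<not> nsets D 2 \<subseteq> F \<and> nsets D 2 \<inter> F \<noteq> {}"
    using exists_graph_without_homogeneous_set[OF choose_power2_less[OF assms(1)]] by blast
  have "N \<le> card (Pow {..<(2::nat) ^ r})" using assms(3) by (simp add: card_Pow)
  then obtain V where V: "V \<subseteq> Pow {..<(2::nat) ^ r}" "card V = N" "finite V"
    by (metis obtain_subset_with_card_n)
  have finV: "finite A" if "A \<in> V" for A
    using that V(1) by (auto intro: finite_subset)
  have inj: "inj_on binary_point V" using finV by (rule inj_on_binary_point)
  define edges where "edges I = {top_diff A B |A B. A \<in> I \<and> B \<in> I \<and> A \<noteq> B}" for I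
  \<comment> \<open>A colouring acts on points, so the triple is first decoded into the sets of
    \<open>V\<close> that index it.\<close>
  define col where "col T \<longleftrightarrow> edges {A \<in> V. binary_point A \<in> T} \<in> F" for T
  have "card (binary_point ` V) = N" using inj V(2) by (simp add: card_image)
  then obtain S where S: "S \<in> nsets (binary_point ` V) n" "convex_position S" "monochromatic col S"
    using ramsey general_position_binary_point[of V] finV V(3)
    unfolding convex_ramsey_def by blast
  then have finS: "finite S" "card S = n" "S \<subseteq> binary_point ` V" by (auto simp: nsets_def)
  obtain U where U: "U \<subseteq> S" "card S \<le> 2 * card U"
    "(\<forall>a\<in>U. \<forall>b\<in>U. \<forall>c\<in>U. a $ 1 < b $ 1 \<longrightarrow> b $ 1 < c $ 1 \<longrightarrow> orient a b c \<le> 0) \<or>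
     (\<forall>a\<in>U. \<forall>b\<in>U. \<forall>c\<in>U. a $ 1 < b $ 1 \<longrightarrow> b $ 1 < c $ 1 \<longrightarrow> orient a b c \<ge> 0)"
    using convex_position_large_cup_or_cap[OF finS(1) S(2)] by blast
  obtain \<U> where \<U>: "\<U> \<subseteq> V" "U = binary_point ` \<U>"
    using U(1) finS(3) by (metis order_trans subset_imageE)
  have finU: "finite \<U>" "card \<U> = card U"
    using \<U> V(3) inj by (auto simp: card_image inj_on_subset intro: finite_subset)
  \<comment> \<open>Half of \<open>8 * r + 2\<close>. Removing \<open>Z\<close> leaves the
    \<open>4 * r\<close> elements that \<open>F\<close> forbids to be homogeneous.\<close>
  then have cardU: "card \<U> \<ge> 4 * r + 1" using U(2) finS(2) assms(2) by linarith
  then have "\<U> \<noteq> {}" by auto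
  moreover have "finite A" if "A \<in> \<U>" for A using that \<U>(1) finV by blast
  ultimately obtain Z where Z: "Z \<in> \<U>" "inj_on (top_diff Z) (\<U> - {Z})"
    using inj_on_top_diff_of_cup_or_cap[OF finU(1) _ _ U(3)[unfolded \<U>(2)]] by blast
  define D where "D = top_diff Z ` (\<U> - {Z})"
  have "card D \<ge> 4 * r" using Z finU cardU by (simp add: D_def card_image)
  moreover have "D \<subseteq> {..<2 ^ r}"
  proof
    fix d assume "d \<in> D"
    then obtain B where "B \<in> \<U>" "B \<noteq> Z" "d = top_diff Z B" by (auto simp: D_def)
    then have "d \<in> Z \<union> B" using top_diff_mem_Un[of Z B] Z(1) \<U>(1) finV by blast
    then show "d \<in> {..<2 ^ r}" using V(1) \<U>(1) Z(1) \<open>B \<in> \<U>\<close> by blast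
  qed
  ultimately have D: "\<not> nsets D 2 \<subseteq> F" "nsets D 2 \<inter> F \<noteq> {}" using F by blast+
  \<comment> \<open>Each edge on \<open>D\<close> is the edge of a triple containing the point of
    \<open>Z\<close>, so a monochromatic \<open>S\<close> would make \<open>D\<close>
    homogeneous.\<close>
  have edge: "\<exists>T \<in> nsets S 3. col T = (e \<in> F)" if e: "e \<in> nsets D 2" for e
  proof -
    obtain I where "I \<in> nsets (\<U> - {Z}) 2" "e = top_diff Z ` I"
      using e Z(2) unfolding D_def by (rule nset_image_obtains)
    then obtain B C where BC: "B \<in> \<U> - {Z}" "C \<in> \<U> - {Z}" "B \<noteq> C" "e = {top_diff Z B, top_diff Z C}"
      by (auto simp: nsets_2_eq)
    have V3: "Z \<in> V" "B \<in> V" "C \<in> V" using BC Z(1) \<U>(1) by auto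
    have eq: "binary_point A = binary_point A' \<longleftrightarrow> A = A'" if "A \<in> V" "A' \<in> V" for A A'
      using inj that by (auto dest: inj_onD)
    let ?T = "{binary_point Z, binary_point B, binary_point C}"
    have ne': "Z \<noteq> B" "Z \<noteq> C" using BC by auto
    have "?T \<subseteq> S" using BC Z(1) \<U>(2) U(1) by auto
    moreover have "card ?T = 3" using BC(3) ne' by (simp add: eq V3)
    ultimately have T: "?T \<in> nsets S 3" by (auto simp: nsets_def)
    have ne: "top_diff Z B \<noteq> top_diff Z C" using inj_onD[OF Z(2)] BC by blast
    \<comment> \<open>It is the larger of the two, so the triple yields exactly the edge
      \<open>e\<close>.\<close>
    have "top_diff B C \<in> {top_diff Z B, top_diff Z C}"
    proof (cases "top_diff Z B < top_diff Z C")
      case True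
      then show ?thesis
        using top_diff_ultrametric[of B Z C] ne' finV V3 by (simp add: top_diff_commute)
    next
      case False
      then show ?thesis
        using top_diff_ultrametric[of C Z B] ne ne' finV V3 by (simp add: top_diff_commute)
    qed
    then have "edges {Z, B, C} = e"
      using BC(3,4) ne' by (auto simp: edges_def top_diff_commute)
    moreover have "{A \<in> V. binary_point A \<in> ?T} = {Z, B, C}"
      using V3 eq by auto
    ultimately have "col ?T = (e \<in> F)" by (simp add: col_def)
    then show ?thesis using T by blast
  qed
  obtain c where c: "\<forall>T \<in> nsets S 3. col T = c" using S(3) by (auto simp: monochromatic_def)
  then have "(e \<in> F) = c" if "e \<in> nsets D 2" for e using edge[OF that] by auto
  then show False using D by blast
qed

section \<open>The tower estimate\<close>

lemma g_K3_le: "g_K3 n \<le> 4 ^ ((4 ^ (4 * n))\<^sup>2)"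
  unfolding g_K3_def by (rule Least_le) (rule convex_ramsey_upper)

text \<open>The upper bound shows that the minimum is attained, so \<open>g_K3 n\<close> itself has
  the Ramsey property.\<close>

lemma g_K3_gt:
  assumes "r \<ge> 1" "n \<ge> 8 * r + 2"
  shows "g_K3 n > 2 ^ 2 ^ r"
proof (rule ccontr)
  assume "\<not> g_K3 n > 2 ^ 2 ^ r"
  moreover have "convex_ramsey n (g_K3 n)"
    unfolding g_K3_def by (rule LeastI) (rule convex_ramsey_upper)
  ultimately show False using not_convex_ramsey[OF assms] by auto
qed

lemma two_powr_two_powr: "2 powr (2 powr real k) = real (2 ^ 2 ^ k)"
proof -
  have "2 powr real k = real (2 ^ k)" by (simp add: powr_realpow)
  then show ?thesis using powr_realpow[of 2 "2 ^ k"] by simp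
qed

lemma g_K3_lower:
  assumes "n \<ge> 10"
  shows "2 powr (2 powr (real n / 20)) \<le> real (g_K3 n)"
proof -
  \<comment> \<open>For \<open>r\<close> at least 1, \<open>8 * r + 2\<close> is at most
    \<open>10 * r\<close>, hence at most \<open>n\<close>. Also \<open>n < 10 * (r + 1)\<close>,
    which is at most \<open>20 * r\<close>, whence the constant 1/20.\<close>
  define r where "r = n div 10"
  have "real n / 20 \<le> real r"
  proof -
    have "n \<le> 20 * r"
      using assms unfolding r_def by presburger
    then show ?thesis by simp
  qed
  then have "2 powr (2 powr (real n / 20)) \<le> 2 powr (2 powr real r)"
    by (intro powr_mono) auto
  also have "\<dots> = real (2 ^ 2 ^ r)" by (rule two_powr_two_powr)
  also have "\<dots> \<le> real (g_K3 n)"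
    using g_K3_gt[of r n] assms unfolding r_def of_nat_le_iff by linarith
  finally show ?thesis .
qed

lemma g_K3_upper:
  assumes "n \<ge> 1"
  shows "real (g_K3 n) \<le> 2 powr (2 powr (17 * real n))"
proof -
  have "(4::nat) ^ ((4 ^ (4 * n))\<^sup>2) = 2 ^ (2 * (4 ^ (4 * n))\<^sup>2)"
    by (simp add: power_mult)
  \<comment> \<open>The 1 comes from writing the outer base 4 as a square; \<open>n \<ge> 1\<close>
    then absorbs it into \<open>17 * n\<close>.\<close>
  also have "2 * (4 ^ (4 * n))\<^sup>2 = (2::nat) ^ (16 * n + 1)"
  proof -
    have "(4::nat) ^ (4 * n) = 2 ^ (8 * n)" by (simp add: power_mult)
    then show ?thesis by (simp flip: power_mult)
  qed
  also have "(2::nat) ^ 2 ^ (16 * n + 1) \<le> 2 ^ 2 ^ (17 * n)"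
    using assms by (intro power_increasing) auto
  finally have "g_K3 n \<le> 2 ^ 2 ^ (17 * n)" using g_K3_le[of n] by (rule le_trans[rotated])
  then have "real (g_K3 n) \<le> real (2 ^ 2 ^ (17 * n))" by (simp only: of_nat_le_iff)
  also have "\<dots> = 2 powr (2 powr real (17 * n))" by (rule two_powr_two_powr[symmetric])
  finally show ?thesis by simp
qed

theorem theorem3:
  shows "(\<exists>c::real. c > 0 \<and>
            (\<forall>\<^sub>F n in sequentially. real (g_K3 n) \<ge> 2 powr (2 powr (c * real n)))) \<and>
         (\<exists>f :: nat \<Rightarrow> real. f \<in> \<Theta>(\<lambda>n. real n) \<and>
            (\<forall>\<^sub>F n in sequentially. real (g_K3 n) = twr 3 (f n)))"
proof (intro conjI)
  have "\<forall>\<^sub>F n in sequentially. real (g_K3 n) \<ge> 2 powr (2 powr (1/20 * real n))"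
    using eventually_ge_at_top[of 10] by eventually_elim (use g_K3_lower in simp)
  then show "\<exists>c::real. c > 0 \<and>
            (\<forall>\<^sub>F n in sequentially. real (g_K3 n) \<ge> 2 powr (2 powr (c * real n)))"
    by (intro exI[of _ "1/20"]) simp
next
  \<comment> \<open>The inverse of \<open>twr 3\<close> at \<open>g_K3 n\<close>, so equality is
    exact and the two bounds become linear.\<close>
  define f where "f n = log 2 (log 2 (real (g_K3 n)))" for n
  have f: "real n / 20 \<le> f n \<and> f n \<le> 17 * real n \<and> real (g_K3 n) = twr 3 (f n)"
    if n: "n \<ge> 10" for n
  proof -
    let ?g = "real (g_K3 n)"
    have lo: "2 powr (2 powr (real n / 20)) \<le> ?g" and hi: "?g \<le> 2 powr (2 powr (17 * real n))"
      using g_K3_lower[OF n] g_K3_upper[of n] n by auto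
    have g0: "?g > 0" by (rule less_le_trans[OF _ lo]) simp
    have lo1: "2 powr (real n / 20) \<le> log 2 ?g" and hi1: "log 2 ?g \<le> 2 powr (17 * real n)"
      using lo hi g0 by (simp_all add: le_log_iff log_le_iff)
    \<comment> \<open>Positivity makes the outer logarithm in \<open>f\<close> a true inverse of the
      power.\<close>
    have l0: "log 2 ?g > 0" by (rule less_le_trans[OF _ lo1]) simp
    have "real n / 20 \<le> f n" using lo1 l0 unfolding f_def by (subst le_log_iff) simp_all
    moreover have "f n \<le> 17 * real n" using hi1 l0 unfolding f_def by (subst log_le_iff) simp_all
    moreover have "?g = twr 3 (f n)"
      using g0 l0 by (simp add: f_def eval_nat_numeral)
    ultimately show ?thesis by simp
  qed
  have "f \<in> \<Theta>(\<lambda>n. real n)"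
  proof (rule bigthetaI')
    show "\<forall>\<^sub>F n in sequentially. 1/20 * norm (real n) \<le> norm (f n) \<and> norm (f n) \<le> 17 * norm (real n)"
      using eventually_ge_at_top[of 10]
    proof eventually_elim
      case (elim n)
      then show ?case using f[of n] by simp
    qed
  qed auto
  moreover have "\<forall>\<^sub>F n in sequentially. real (g_K3 n) = twr 3 (f n)"
    using eventually_ge_at_top[of 10] by eventually_elim (use f in blast)
  ultimately show "\<exists>f :: nat \<Rightarrow> real. f \<in> \<Theta>(\<lambda>n. real n) \<and>
            (\<forall>\<^sub>F n in sequentially. real (g_K3 n) = twr 3 (f n))" by blast
qed

end
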